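(* It is not true that for every matroid the sequence counting flats by rank is unimodal. That is, there exists a (finite) matroid $M$, of some rank $r$, such that, writing $W_i$ for the number of flats of $M$ of rank $i$ ($0 \le i \le r$), there is no integer $k$ with $0 \le k \le r$ satisfying $$W_0 \le W_1 \le \cdots \le W_{k-1} \le W_k \ge W_{k+1} \ge \cdots \ge W_r.$$
   Context: Matroids are on finite ground sets. For a matroid $M$ with ground set $E(M)$ and rank function $r_M$, a flat of $M$ of rank $i$ is a maximal subset of $E(M)$ having rank $i$. The rank of $M$ is $r = r_M(E(M))$. *)

theory Defs
  imports Main
begin

locale matroid =
  fixes ground :: "'a set" and indep :: "'a set \<Rightarrow> bool"
  assumes finite_ground: "finite ground"
    and indep_subset_ground: "indep I \<Longrightarrow> I \<subseteq> ground"
    and indep_empty: "indep {}"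
    and indep_mono: "indep J \<Longrightarrow> I \<subseteq> J \<Longrightarrow> indep I"
    and indep_augment:
      "indep I \<Longrightarrow> indep J \<Longrightarrow> card I < card J \<Longrightarrow> \<exists>x\<in>J - I. indep (insert x I)"

(* Meaningful for finite X, which includes every subset of the ground set of a matroid. *)
definition matroid_rank :: "('a set \<Rightarrow> bool) \<Rightarrow> 'a set \<Rightarrow> nat" where
  "matroid_rank indep X = Max (card ` {I. I \<subseteq> X \<and> indep I})"

definition rank_flat :: "'a set \<Rightarrow> ('a set \<Rightarrow> bool) \<Rightarrow> nat \<Rightarrow> 'a set \<Rightarrow> bool" where
  "rank_flat ground indep i F \<longleftrightarrow>
     F \<subseteq> ground \<and> matroid_rank indep F = i \<and>
     (\<forall>G. F \<subset> G \<and> G \<subseteq> ground \<longrightarrow> matroid_rank indep G \<noteq> i)"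

definition num_flats :: "'a set \<Rightarrow> ('a set \<Rightarrow> bool) \<Rightarrow> nat \<Rightarrow> nat" where
  "num_flats ground indep i = card {F. rank_flat ground indep i F}"

(* Only the terms a 0, ..., a r of the sequence matter. *)
definition unimodal_upto :: "nat \<Rightarrow> (nat \<Rightarrow> nat) \<Rightarrow> bool" where
  "unimodal_upto r a \<longleftrightarrow>
     (\<exists>k\<le>r. (\<forall>i<k. a i \<le> a (Suc i)) \<and> (\<forall>i. k \<le> i \<and> i < r \<longrightarrow> a (Suc i) \<le> a i))"

end

theory Submission
  imports Defs "HOL-Analysis.Cartesian_Space" "Berlekamp_Zassenhaus.Finite_Field"
begin

text \<open>
  Work in \<open>F\<^sup>10\<close> over a field with \<open>q\<close> elements, \<open>q\<close> large, and start from the linear matroid, truncated to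
  rank 8, of a set of points with two parts. The first part consists of five affine 5-spaces with a
  common hyperplane at infinity; choosing one point from each gives \<open>q\<^sup>25\<close> flats of rank 5. The
  flats of rank 6 correspond to certain 6-dimensional subspaces of \<open>F\<^sup>10\<close>, so there are at most
  about \<open>q\<^sup>24\<close> of them. The second part is a cone, with its vertex removed, over a rational normal
  scroll. About \<open>q\<^sup>18\<close> subspaces of dimension 7 miss the first part and cut the second part in a
  rational normal curve: \<open>q\<close> points, any 7 of them independent. Relaxing these uniform hyperplanes,
  that is, declaring their 8-element subsets independent, is compatible with the matroid axioms
  and does not affect the flats of rank at most 6, but replaces each of them by
  \<open>q choose 7\<close> flats of rank 7. This yields about \<open>q\<^sup>25 / 7!\<close> flats of rank 7, so that
  \<open>W\<^sub>5 > W\<^sub>6 < W\<^sub>7\<close>.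
\<close>

section \<open>Relaxations of linear matroids\<close>

text \<open>
  The linear matroid on \<open>E\<close>, truncated to rank \<open>r\<close>, with all hyperplanes relaxed that are uniform of
  rank \<open>r - 1\<close>. The second disjunct says that \<open>I\<close> spans such a hyperplane if \<open>I\<close> is dependent.
\<close>

definition relaxed ::
    "('f :: {field, finite} ^ 'n) set \<Rightarrow> nat \<Rightarrow> ('f ^ 'n) set \<Rightarrow> bool" where
  "relaxed E r I \<longleftrightarrow> I \<subseteq> E \<and>
     (vec.independent I \<and> card I \<le> r \<or>
      card I = r \<and> (\<forall>A \<subseteq> E \<inter> vec.span I. card A < r \<longrightarrow> vec.independent A))"

lemma relaxed_card_le: "relaxed E r I \<Longrightarrow> card I \<le> r"
  by (auto simp: relaxed_def)

lemma relaxed_independent: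
  assumes "relaxed E r I" "card I < r"
  shows "vec.independent I"
  using assms by (auto simp: relaxed_def)

lemma span_subset_of_card:
  fixes A B :: "('f :: {field, finite} ^ 'n) set"
  assumes "vec.independent A" "A \<subseteq> vec.span B" "card B \<le> card A"
  shows "vec.span A = vec.span B"
proof
  show "vec.span A \<subseteq> vec.span B"
    using assms(2) by (simp add: vec.span_minimal)
  have "vec.dim (vec.span B) \<le> card A"
    using vec.dim_le_card[of "vec.span B" B] assms(3) by simp
  then show "vec.span B \<subseteq> vec.span A"
    using vec.card_ge_dim_independent[OF assms(2,1)] by simp
qed

text \<open>A dependent relaxed set is a circuit: dropping any element leaves an independent set by
  the uniformity condition, and the dropped element lies in the span of the rest.\<close>

lemma relaxed_dependent_spanning_subset:
  assumes J: "relaxed E r J" and dep: "\<not> vec.independent J" and r: "r > 0"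
  obtains A where "A \<subseteq> J" "vec.independent A" "card A = r - 1" "vec.span A = vec.span J"
proof -
  have JE: "J \<subseteq> E" and cJ: "card J = r"
    and str: "\<And>A. A \<subseteq> E \<inter> vec.span J \<Longrightarrow> card A < r \<Longrightarrow> vec.independent A"
    using J dep by (auto simp: relaxed_def)
  from cJ r obtain z where z: "z \<in> J"
    by fastforce
  let ?A = "J - {z}"
  have card: "card ?A = r - 1"
    using z cJ by simp
  have ind: "vec.independent ?A"
  proof (rule str)
    show "?A \<subseteq> E \<inter> vec.span J"
      using JE vec.span_superset[of J] by blast
    show "card ?A < r"
      using card r by simp
  qed
  have "z \<in> vec.span ?A"
    using dep ind z vec.independent_insertI[of z ?A] by (auto simp: insert_absorb)
  then have "vec.span ?A = vec.span J"
    using vec.span_redundant[of z ?A] z by (simp add: insert_absorb)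
  then show thesis
    using that[of ?A] card ind by blast
qed

text \<open>The work is in augmentation. If \<open>J\<close> leaves the span of \<open>I\<close>,
  any element of \<open>J\<close> outside that span extends \<open>I\<close>. Otherwise
  \<open>J\<close>, being larger than \<open>I\<close>, is dependent, and the relaxed hyperplane it
  spans must be the span of \<open>I\<close>.\<close>

lemma matroid_relaxed: "matroid E (relaxed E r)" if "r > 0"
proof
  show "finite E" by simp
  show "I \<subseteq> E" if "relaxed E r I" for I
    using that by (simp add: relaxed_def)
  show "relaxed E r {}"
    by (simp add: relaxed_def vec.independent_empty)
  show "relaxed E r I" if J: "relaxed E r J" and IJ: "I \<subseteq> J" for I J
  proof (cases "I = J")
    case False
    then have "card I < card J"
      using IJ by (simp add: psubset_card_mono psubsetI)
    moreover have "I \<subseteq> vec.span J"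
      using IJ vec.span_superset[of J] by blast
    ultimately show ?thesis
      using J IJ by (auto simp: relaxed_def dest: vec.dependent_mono[OF _ IJ])
  qed (use J in simp)
  show "\<exists>x\<in>J - I. relaxed E r (insert x I)"
    if I: "relaxed E r I" and J: "relaxed E r J" and lt: "card I < card J" for I J
  proof -
    have cI: "card I < r"
      using lt relaxed_card_le[OF J] by simp
    have indI: "vec.independent I"
      using I cI by (rule relaxed_independent)
    have IE: "I \<subseteq> E" and JE: "J \<subseteq> E"
      using I J by (simp_all add: relaxed_def)
    show ?thesis
    proof (cases "J \<subseteq> vec.span I")
      case False
      then obtain x where x: "x \<in> J" "x \<notin> vec.span I"
        by blast
      then have "x \<notin> I"
        using vec.span_base by blast
      moreover have "vec.independent (insert x I)"
        using indI x by (simp add: vec.independent_insertI)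
      ultimately show ?thesis
        using x(1) IE JE cI by (auto simp: relaxed_def intro!: bexI[of _ x])
    next
      case True
      have dep: "\<not> vec.independent J"
        using vec.independent_span_bound[of I J] True lt by auto
      have cJ: "card J = r"
        and str: "\<And>A. A \<subseteq> E \<inter> vec.span J \<Longrightarrow> card A < r \<Longrightarrow> vec.independent A"
        using J dep by (auto simp: relaxed_def)
      obtain A where A: "A \<subseteq> J" "vec.independent A" "card A = r - 1" "vec.span A = vec.span J"
        using relaxed_dependent_spanning_subset[OF J dep \<open>r > 0\<close>] .
      have AI: "A \<subseteq> vec.span I"
        using A(1) True by blast
      have span: "vec.span J = vec.span I"
        using span_subset_of_card[OF A(2) AI] A(3,4) cI by simp
      have "card A \<le> card I"
        using vec.independent_span_bound[OF _ A(2) AI] by simp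
      then have cI': "Suc (card I) = r"
        using A(3) cI by simp
      obtain x where x: "x \<in> J" "x \<notin> I"
        using lt by (meson card_mono finite not_less subsetI)
      \<comment> \<open>The uniformity condition depends on a set only through its span and its size
        \<open>r\<close>, so it passes from \<open>J\<close> to \<open>insert x I\<close>.\<close>
      have "vec.span (insert x I) = vec.span J"
        using x(1) True span by (simp add: subsetD vec.span_redundant)
      then have "relaxed E r (insert x I)"
        using x JE IE cI' str by (auto simp: relaxed_def)
      then show ?thesis
        using x by blast
    qed
  qed
qed

section \<open>Ranks and flats below the relaxed level\<close>

lemma matroid_rank_eqI:
  assumes "I \<subseteq> F" "indep I" "card I = k" "finite F"
    and "\<And>J. J \<subseteq> F \<Longrightarrow> indep J \<Longrightarrow> card J \<le> k"
  shows "matroid_rank indep F = k"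
  unfolding matroid_rank_def using assms by (intro Max_eqI) auto

lemma card_le_matroid_rank:
  assumes "I \<subseteq> F" "indep I" "finite F"
  shows "card I \<le> matroid_rank indep F"
  unfolding matroid_rank_def using assms by (intro Max_ge) auto

lemma matroid_rank_attained:
  assumes "finite F" "indep {}"
  obtains I where "I \<subseteq> F" "indep I" "card I = matroid_rank indep F"
proof -
  have "matroid_rank indep F \<in> card ` {I. I \<subseteq> F \<and> indep I}"
    unfolding matroid_rank_def using assms by (intro Max_in) auto
  then show thesis
    using that by auto
qed

text \<open>Relaxation does not alter ranks below \<open>r - 1\<close>: a dependent relaxed subset
  of \<open>F\<close> would contain \<open>r - 1\<close> independent vectors, more than the span of
  \<open>B\<close> can hold.\<close>

lemma relaxed_rank_spanned:
  assumes "B \<subseteq> F" "vec.independent B" "F \<subseteq> E" "F \<subseteq> vec.span B" "Suc (card B) < r"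
  shows "matroid_rank (relaxed E r) F = card B"
proof (rule matroid_rank_eqI[where I = B])
  show "relaxed E r B"
    using assms by (auto simp: relaxed_def)
  fix J assume J: "J \<subseteq> F" "relaxed E r J"
  have bound: "card A \<le> card B" if "A \<subseteq> J" "vec.independent A" for A
    using vec.independent_span_bound[of B A] that J(1) assms(4) by auto
  show "card J \<le> card B"
  proof (cases "vec.independent J")
    case False
    then obtain A where "A \<subseteq> J" "vec.independent A" "card A = r - 1"
      using relaxed_dependent_spanning_subset[OF J(2)] assms(5) by (metis gr0I not_less0)
    then show ?thesis
      using bound[of A] assms(5) by simp
  qed (use bound in simp)
qed (use assms in simp_all)

text \<open>A larger \<open>G\<close> contains a vector outside the span of \<open>B\<close>; adding
  it to \<open>B\<close> gives an independent set of size \<open>k + 1 < r\<close>, so the rank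
  grows.\<close>

lemma rank_flat_relaxed_span:
  assumes B: "B \<subseteq> E" "vec.independent B" and k: "card B = k" "Suc k < r"
  shows "rank_flat E (relaxed E r) k (E \<inter> vec.span B)"
  unfolding rank_flat_def
proof (intro conjI allI impI)
  have BF: "B \<subseteq> E \<inter> vec.span B"
    using B(1) vec.span_superset[of B] by blast
  then show "matroid_rank (relaxed E r) (E \<inter> vec.span B) = k"
    using relaxed_rank_spanned[OF BF B(2)] k by simp
  fix G assume G: "E \<inter> vec.span B \<subset> G \<and> G \<subseteq> E"
  then obtain x where x: "x \<in> G" "x \<notin> vec.span B"
    by blast
  have "relaxed E r (insert x B)"
    using B x G k by (auto simp: relaxed_def vec.independent_insertI card_insert_if)
  moreover have "insert x B \<subseteq> G"
    using x BF G by blast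
  ultimately have "card (insert x B) \<le> matroid_rank (relaxed E r) G"
    by (intro card_le_matroid_rank) simp_all
  moreover have "x \<notin> B"
    using x(2) vec.span_base by blast
  ultimately show "matroid_rank (relaxed E r) G \<noteq> k"
    using k by simp
qed simp

text \<open>An independent subset of \<open>F\<close> of size \<open>k\<close> must span
  \<open>F\<close>, as any vector of \<open>F\<close> outside its span could be added. Since the
  trace of that span on \<open>E\<close> also has rank \<open>k\<close>, maximality makes it equal
  to \<open>F\<close>.\<close>

lemma rank_flat_relaxedD:
  assumes F: "rank_flat E (relaxed E r) k F" and k: "Suc k < r"
  obtains B where "B \<subseteq> E" "vec.independent B" "card B = k" "F = E \<inter> vec.span B"
proof -
  have FE: "F \<subseteq> E" and rk: "matroid_rank (relaxed E r) F = k"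
    and max: "\<And>G. F \<subset> G \<Longrightarrow> G \<subseteq> E \<Longrightarrow> matroid_rank (relaxed E r) G \<noteq> k"
    using F by (auto simp: rank_flat_def)
  have "relaxed E r {}"
    by (simp add: relaxed_def vec.independent_empty)
  then obtain B where B: "B \<subseteq> F" "relaxed E r B" "card B = k"
    using matroid_rank_attained[OF finite] rk by metis
  have ind: "vec.independent B"
    using relaxed_independent[OF B(2)] B(3) k by simp
  have "F \<subseteq> vec.span B"
  proof
    fix x assume x: "x \<in> F"
    show "x \<in> vec.span B"
    proof (rule ccontr)
      assume nx: "x \<notin> vec.span B"
      then have "x \<notin> B"
        using vec.span_base by blast
      moreover have "relaxed E r (insert x B)"
        using nx x FE B ind k by (auto simp: relaxed_def vec.independent_insertI card_insert_if)
      ultimately show False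
        using card_le_matroid_rank[of "insert x B" F "relaxed E r"] x B rk by simp
    qed
  qed
  then have sub: "F \<subseteq> E \<inter> vec.span B"
    using FE by blast
  have "matroid_rank (relaxed E r) (E \<inter> vec.span B) = k"
    using rank_flat_relaxed_span[of B E k r] B FE ind k by (auto simp: rank_flat_def)
  then have "F = E \<inter> vec.span B"
    using max[of "E \<inter> vec.span B"] sub by blast
  then show thesis
    using that B FE ind by blast
qed

section \<open>Counting subspaces over a finite field\<close>

lemma card_span_independent:
  fixes B :: "('f :: {field, finite} ^ 'n) set"
  assumes "vec.independent B"
  shows "card (vec.span B) = CARD('f) ^ card B"
proof -
  have "finite B" by simp
  then show ?thesis
    using assms
  proof induction
    case (insert b B)
    have b: "b \<notin> vec.span B" and ind: "vec.independent B"
      using insert.prems insert.hyps by (simp_all add: vec.independent_insert)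
    let ?f = "\<lambda>(c, v). c *s b + v"
    have "inj_on ?f (UNIV \<times> vec.span B)"
    proof (rule inj_onI, clarify)
      fix c d v w
      assume vw: "v \<in> vec.span B" "w \<in> vec.span B" and eq: "c *s b + v = d *s b + w"
      have "(c - d) *s b = w - v"
        using eq by (simp add: vec.scale_left_diff_distrib algebra_simps)
      then have "(c - d) *s b \<in> vec.span B"
        using vw by (simp add: vec.span_diff)
      then have "c - d = 0"
        using b by (metis vec.scale_scale vec.scale_one vec.span_scale left_inverse)
      then show "c = d \<and> v = w"
        using eq by simp
    qed
    moreover have "?f ` (UNIV \<times> vec.span B) = vec.span (insert b B)"
    proof (rule Set.set_eqI)
      fix x
      show "x \<in> ?f ` (UNIV \<times> vec.span B) \<longleftrightarrow> x \<in> vec.span (insert b B)"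
      proof
        assume "x \<in> vec.span (insert b B)"
        then obtain c where "x - c *s b \<in> vec.span B"
          by (auto simp: vec.span_breakdown_eq)
        then show "x \<in> ?f ` (UNIV \<times> vec.span B)"
          by (intro image_eqI[of _ _ "(c, x - c *s b)"]) auto
      next
        assume "x \<in> ?f ` (UNIV \<times> vec.span B)"
        then obtain c v where "x = c *s b + v" "v \<in> vec.span B"
          by auto
        then show "x \<in> vec.span (insert b B)"
          by (auto simp: vec.span_breakdown_eq intro!: exI[of _ c])
      qed
    qed
    ultimately have "card (vec.span (insert b B)) = card ((UNIV :: 'f set) \<times> vec.span B)"
      by (metis card_image)
    then show ?case
      using insert.IH[OF ind] insert.hyps by (simp add: card_cartesian_product)
  qed simp
qed

definition independent_lists :: "('f :: {field, finite} ^ 'n) set \<Rightarrow> nat \<Rightarrow> ('f ^ 'n) list set" where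
  "independent_lists W m =
     {xs. length xs = m \<and> distinct xs \<and> set xs \<subseteq> W \<and> vec.independent (set xs)}"

lemma finite_independent_lists [simp]: "finite (independent_lists W m)"
  by (rule finite_subset[OF _ finite_lists_length_eq[of UNIV m]])
    (auto simp: independent_lists_def)

text \<open>Vectors are chosen one at a time, each avoiding the span of the earlier ones. That span
  has at most \<open>CARD('f) ^ k\<close> elements at every step; using this worst case throughout
  makes the bound a plain power.\<close>

lemma card_independent_lists_ge:
  fixes W :: "('f :: {field, finite} ^ 'n) set"
  assumes W: "card W = CARD('f) ^ Suc k" and m: "m \<le> Suc k"
  shows "(CARD('f) ^ Suc k - CARD('f) ^ k) ^ m \<le> card (independent_lists W m)"
  using m
proof (induction m)
  case 0
  have "independent_lists W 0 = {[]}"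
    by (auto simp: independent_lists_def vec.independent_empty)
  then show ?case by simp
next
  case (Suc m)
  let ?q = "CARD('f)"
  let ?f = "\<lambda>(xs, x). x # xs"
  let ?S = "SIGMA xs : independent_lists W m. W - vec.span (set xs)"
  have sub: "?f ` ?S \<subseteq> independent_lists W (Suc m)"
    by (auto simp: independent_lists_def vec.independent_insertI vec.span_base)
  have "card (?f ` ?S) = card ?S"
    by (rule card_image) (auto simp: inj_on_def)
  have ge: "?q ^ Suc k - ?q ^ k \<le> card (W - vec.span (set xs))"
    if "xs \<in> independent_lists W m" for xs
  proof -
    have "card (vec.span (set xs)) = ?q ^ m"
      using that by (simp add: independent_lists_def card_span_independent distinct_card)
    also have "\<dots> \<le> ?q ^ k"
      using Suc.prems by (intro power_increasing) (auto simp: Suc_le_eq)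
    finally have "card W - ?q ^ k \<le> card W - card (vec.span (set xs))"
      by simp
    also have "\<dots> \<le> card (W - vec.span (set xs))"
      by (intro diff_card_le_card_Diff) simp
    finally show ?thesis
      using W by simp
  qed
  have "(?q ^ Suc k - ?q ^ k) ^ Suc m
      \<le> card (independent_lists W m) * (?q ^ Suc k - ?q ^ k)"
    using Suc by (simp add: mult.commute mult_le_mono1 del: power_Suc) (simp add: mult.commute)
  also have "\<dots> \<le> (\<Sum>xs\<in>independent_lists W m. card (W - vec.span (set xs)))"
    using sum_bounded_below[of "independent_lists W m" "?q ^ Suc k - ?q ^ k"] ge by simp
  also have "\<dots> = card ?S"
    by simp
  also have "\<dots> = card (?f ` ?S)"
    by (rule card_image[symmetric]) (auto simp: inj_on_def)
  also have "\<dots> \<le> card (independent_lists W (Suc m))"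
    using sub by (intro card_mono) simp_all
  finally show ?case .
qed

text \<open>Double counting: a list of \<open>Suc k\<close> independent vectors in a member of
  \<open>S\<close> spans that member, so different members have disjoint sets of such lists, all
  contained in the set of lists of length \<open>Suc k\<close>.\<close>

lemma card_subspaces_le:
  fixes S :: "('f :: {field, finite} ^ 'n) set set"
  assumes S: "S = {vec.span B |B. vec.independent B \<and> card B = Suc k}"
  shows "card S * (CARD('f) ^ Suc k - CARD('f) ^ k) ^ Suc k \<le> (CARD('f) ^ CARD('n)) ^ Suc k"
proof -
  let ?L = "\<lambda>W :: ('f ^ 'n) set. independent_lists W (Suc k)"
  have span: "vec.span (set xs) = W" if W: "W \<in> S" and xs: "xs \<in> ?L W" for W xs
  proof -
    obtain B where B: "W = vec.span B" "vec.independent B" "card B = Suc k"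
      using W S by auto
    show ?thesis
      using span_subset_of_card[of "set xs" B] xs B
      by (auto simp: independent_lists_def distinct_card)
  qed
  have "card S * (CARD('f) ^ Suc k - CARD('f) ^ k) ^ Suc k \<le> (\<Sum>W\<in>S. card (?L W))"
  proof -
    have "(CARD('f) ^ Suc k - CARD('f) ^ k) ^ Suc k \<le> card (?L W)" if "W \<in> S" for W
      using that S by (intro card_independent_lists_ge) (auto simp: card_span_independent)
    then show ?thesis
      using sum_bounded_below[of S "(CARD('f) ^ Suc k - CARD('f) ^ k) ^ Suc k" "\<lambda>W. card (?L W)"]
      by simp
  qed
  also have "\<dots> = card (\<Union>W\<in>S. ?L W)"
    using span by (intro card_UN_disjoint[symmetric]) auto
  also have "\<dots> \<le> card {xs :: ('f ^ 'n) list. set xs \<subseteq> UNIV \<and> length xs = Suc k}"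
    by (intro card_mono finite_lists_length_eq) (auto simp: independent_lists_def)
  also have "\<dots> = (CARD('f) ^ CARD('n)) ^ Suc k"
    by (subst card_lists_length_eq) simp_all
  finally show ?thesis .
qed

lemma num_flats_relaxed_le:
  fixes E :: "('f :: {field, finite} ^ 'n) set"
  assumes "Suc (Suc k) < r"
  shows "num_flats E (relaxed E r) (Suc k) * (CARD('f) ^ Suc k - CARD('f) ^ k) ^ Suc k
    \<le> (CARD('f) ^ CARD('n)) ^ Suc k"
proof -
  let ?S = "{vec.span B |B :: ('f ^ 'n) set. vec.independent B \<and> card B = Suc k}"
  have "{F. rank_flat E (relaxed E r) (Suc k) F} \<subseteq> (\<lambda>W. E \<inter> W) ` ?S"
  proof clarify
    fix F assume "rank_flat E (relaxed E r) (Suc k) F"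
    then show "F \<in> (\<lambda>W. E \<inter> W) ` ?S"
      using assms by (rule rank_flat_relaxedD) blast
  qed
  then have "num_flats E (relaxed E r) (Suc k) \<le> card ?S"
    unfolding num_flats_def by (rule surj_card_le[OF finite])
  then have "num_flats E (relaxed E r) (Suc k) * (CARD('f) ^ Suc k - CARD('f) ^ k) ^ Suc k
      \<le> card ?S * (CARD('f) ^ Suc k - CARD('f) ^ k) ^ Suc k"
    by (rule mult_le_mono1)
  also have "\<dots> \<le> (CARD('f) ^ CARD('n)) ^ Suc k"
    by (rule card_subspaces_le) (rule refl)
  finally show ?thesis .
qed

section \<open>Transport to a ground set of natural numbers\<close>

lemma transport_to_nat:
  fixes E :: "'a :: finite set"
  assumes "matroid E indep"
  obtains ground' :: "nat set" and indep'
  where "matroid ground' indep'" "matroid_rank indep' ground' = matroid_rank indep E"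
    "\<And>i. num_flats ground' indep' i = num_flats E indep i"
proof -
  interpret matroid E indep by fact
  obtain f :: "'a \<Rightarrow> nat" where f: "inj f"
    using finite_imp_inj_to_nat_seg[of "UNIV :: 'a set"] by auto
  have card [simp]: "card (f ` A) = card A" for A
    using f by (meson card_image inj_on_subset subset_UNIV)
  have sub [simp]: "f ` A \<subseteq> f ` B \<longleftrightarrow> A \<subseteq> B" for A B
    using f by (simp add: inj_image_subset_iff)
  have psub [simp]: "f ` A \<subset> f ` B \<longleftrightarrow> A \<subset> B" for A B
    using f by (simp add: psubset_eq inj_image_subset_iff inj_image_eq_iff)
  define indep' where "indep' I \<longleftrightarrow> (\<exists>J. I = f ` J \<and> indep J)" for I
  have indep' [simp]: "indep' (f ` J) \<longleftrightarrow> indep J" for J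
    using f by (auto simp: indep'_def inj_image_eq_iff)
  have "matroid (f ` E) indep'"
  proof
    show "finite (f ` E)" by simp
    show "I \<subseteq> f ` E" if "indep' I" for I
      using that indep_subset_ground by (auto simp: indep'_def)
    show "indep' {}"
      using indep_empty by (auto simp: indep'_def)
    show "indep' I" if J: "indep' J" "I \<subseteq> J" for I J
    proof -
      obtain J' where J': "J = f ` J'" "indep J'"
        using J by (auto simp: indep'_def)
      then obtain I' where "I' \<subseteq> J'" "I = f ` I'"
        using J(2) by (meson subset_image_iff)
      then show ?thesis
        using J' indep_mono by auto
    qed
    show "\<exists>x\<in>J - I. indep' (insert x I)" if I: "indep' I" "indep' J" "card I < card J" for I J
    proof -
      obtain I' J' where IJ: "I = f ` I'" "indep I'" "J = f ` J'" "indep J'"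
        using I by (auto simp: indep'_def)
      then obtain x where x: "x \<in> J' - I'" "indep (insert x I')"
        using indep_augment[of I' J'] I(3) by auto
      have "indep' (insert (f x) I)"
        using indep'[of "insert x I'"] x(2) IJ by simp
      moreover have "f x \<in> J - I"
        using x(1) IJ f by (auto simp: inj_image_mem_iff)
      ultimately show ?thesis by blast
    qed
  qed
  moreover have rank [simp]: "matroid_rank indep' (f ` F) = matroid_rank indep F" for F
  proof -
    have "{I. I \<subseteq> f ` F \<and> indep' I} = (`) f ` {I. I \<subseteq> F \<and> indep I}"
      by (auto simp: subset_image_iff)
    then show ?thesis
      by (simp add: matroid_rank_def image_image)
  qed
  moreover have "num_flats (f ` E) indep' i = num_flats E indep i" for i
  proof -
    have flat: "rank_flat (f ` E) indep' i (f ` F) \<longleftrightarrow> rank_flat E indep i F" for F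
    proof -
      have "(\<forall>G. f ` F \<subset> G \<and> G \<subseteq> f ` E \<longrightarrow> matroid_rank indep' G \<noteq> i) \<longleftrightarrow>
        (\<forall>G. F \<subset> G \<and> G \<subseteq> E \<longrightarrow> matroid_rank indep G \<noteq> i)"
        by (metis psub rank subset_image_iff)
      then show ?thesis
        by (simp add: rank_flat_def)
    qed
    have "{F. rank_flat (f ` E) indep' i F} = (`) f ` {F. rank_flat E indep i F}"
    proof -
      have "F \<subseteq> f ` E" if "rank_flat (f ` E) indep' i F" for F
        using that by (simp add: rank_flat_def)
      then show ?thesis
        using flat by (auto simp: subset_image_iff) (metis flat imageI mem_Collect_eq)
    qed
    moreover have "inj_on ((`) f) {F. rank_flat E indep i F}"
      using f by (simp add: inj_on_def inj_image_eq_iff)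
    ultimately show ?thesis
      by (simp add: num_flats_def card_image)
  qed
  ultimately show thesis
    using that by blast
qed

section \<open>The point configuration\<close>

text \<open>
  The coordinates \<open>U1\<close>, \<open>U2\<close> are those of the vertex of the cone over the scroll. The affine pieces are
  indexed by \<open>C0\<close>, \<open>C1\<close>, \<open>C2\<close>, \<open>C3\<close>, \<open>Y\<close> and parametrised by the other five coordinates.
\<close>

datatype coord = U1 | U2 | Z1 | Z2 | Z3 | C0 | C1 | C2 | C3 | Y

lemma UNIV_coord: "UNIV = {U1, U2, Z1, Z2, Z3, C0, C1, C2, C3, Y}"
  by (auto intro: coord.exhaust)

instance coord :: finite
  by standard (simp add: UNIV_coord)

lemma CARD_coord [simp]: "CARD(coord) = 10"
  by (simp add: UNIV_coord)

definition tops :: "coord set" where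
  "tops = {C0, C1, C2, C3, Y}"

definition affine_points :: "('f :: {field, finite} ^ coord) set" where
  "affine_points = {v. \<exists>k\<in>tops. \<forall>i\<in>tops. v $ i = of_bool (i = k)}"

text \<open>Without \<open>U1\<close> and \<open>U2\<close> the entries are
  \<open>1, x, x^2, x^3\<close> and \<open>y\<close> times these: an affine chart of the rational
  normal scroll S(3,3) in projective 7-space.\<close>

definition scroll_point :: "'f :: {field, finite} \<Rightarrow> 'f \<Rightarrow> 'f \<Rightarrow> 'f \<Rightarrow> 'f ^ coord" where
  "scroll_point x y a b = (\<chi> i. case i of
     U1 \<Rightarrow> a | U2 \<Rightarrow> b | Z1 \<Rightarrow> x * y | Z2 \<Rightarrow> x ^ 2 * y | Z3 \<Rightarrow> x ^ 3 * y |
     C0 \<Rightarrow> 1 | C1 \<Rightarrow> x | C2 \<Rightarrow> x ^ 2 | C3 \<Rightarrow> x ^ 3 | Y \<Rightarrow> y)"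

definition points :: "('f :: {field, finite} ^ coord) set" where
  "points = affine_points \<union> {scroll_point x y a b |x y a b. True}"

text \<open>Since \<open>a\<close> and \<open>b\<close> are free, this is the cone over the section
  \<open>y = poly h x\<close> of the scroll. The 7-dimensional spaces considered below pick at most
  one pair \<open>(a, b)\<close> for each \<open>x\<close>.\<close>

definition curve :: "'f :: {field, finite} poly \<Rightarrow> ('f ^ coord) set" where
  "curve h = {scroll_point x (poly h x) a b |x a b. True}"

lemma scroll_point_nth [simp]:
  "scroll_point x y a b $ U1 = a" "scroll_point x y a b $ U2 = b"
  "scroll_point x y a b $ Z1 = x * y" "scroll_point x y a b $ Z2 = x ^ 2 * y"
  "scroll_point x y a b $ Z3 = x ^ 3 * y" "scroll_point x y a b $ C0 = 1"
  "scroll_point x y a b $ C1 = x" "scroll_point x y a b $ C2 = x ^ 2"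
  "scroll_point x y a b $ C3 = x ^ 3" "scroll_point x y a b $ Y = y"
  by (simp_all add: scroll_point_def)

section \<open>Uniform hyperplanes from rational normal curves\<close>

lemma poly_cubic:
  fixes p :: "'a :: comm_ring_1 poly"
  assumes "degree p \<le> 3"
  shows "poly p x = coeff p 0 + coeff p 1 * x + coeff p 2 * x ^ 2 + coeff p 3 * x ^ 3"
proof -
  have "p = [:coeff p 0, coeff p 1, coeff p 2, coeff p 3:]"
    using assms
    by (auto simp: poly_eq_iff coeff_pCons numeral_2_eq_2 numeral_3_eq_3 coeff_eq_0 split: nat.split)
  then have "poly p x = poly [:coeff p 0, coeff p 1, coeff p 2, coeff p 3:] x"
    by simp
  then show ?thesis
    by (simp add: algebra_simps power2_eq_square power3_eq_cube)
qed

text \<open>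
  On the curve, the coordinates other than \<open>U1\<close>, \<open>U2\<close> are \<open>1, x, x\<^sup>2, x\<^sup>3, h, x h, x\<^sup>2 h, x\<^sup>3 h\<close>;
  by division with remainder by the cubic \<open>h\<close> these span all polynomials in \<open>x\<close> of degree at most
  six, in particular the one vanishing exactly at the other points.
\<close>

lemma separating_functional:
  fixes A :: "('f :: {field, finite} ^ coord) set"
  assumes A: "A \<subseteq> curve h" "inj_on (\<lambda>v. v $ C1) A" "card A \<le> 7"
    and h: "degree h = 3" and w: "w \<in> A"
  obtains g where "g U1 = 0" "g U2 = 0"
    "\<And>v. v \<in> A - {w} \<Longrightarrow> (\<Sum>i\<in>UNIV. g i * v $ i) = 0" "(\<Sum>i\<in>UNIV. g i * w $ i) \<noteq> 0"
proof -
  define P where "P = (\<Prod>v\<in>A - {w}. [:- (v $ C1), 1:])"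
  define Q R where "Q = P div h" and "R = P mod h"
  have "degree P \<le> (\<Sum>v\<in>A - {w}. degree [:- (v $ C1), 1:])"
    unfolding P_def by (rule degree_prod_sum_le[unfolded o_def]) simp
  also have "\<dots> = card A - 1"
    using w by simp
  finally have degP: "degree P \<le> 6"
    using A(3) by simp
  have PQR: "P = Q * h + R"
    by (simp add: Q_def R_def)
  have degR: "degree R \<le> 2"
    using degree_mod_less'[of h P] h by (cases "h = 0"; cases "R = 0") (auto simp: R_def)
  have degQ: "degree Q \<le> 3"
  proof (cases "Q = 0")
    case False
    have "degree (Q * h) = degree (P - R)"
      using PQR by simp
    also have "\<dots> \<le> 6"
      using degP degR by (intro degree_diff_le) auto
    finally show ?thesis
      using False h by (subst (asm) degree_mult_eq) auto
  qed simp
  have R3: "coeff R 3 = 0"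
    using degR by (intro coeff_eq_0) simp
  \<comment> \<open>The coefficients of \<open>Q\<close> are paired with
    \<open>h, x h, x^2 h, x^3 h\<close> and those of \<open>R\<close> with \<open>1, x, x^2\<close>,
    so that the functional evaluates \<open>Q * h + R = P\<close> at the \<open>C1\<close>
    coordinate.\<close>
  define g where "g i = (case i of U1 \<Rightarrow> 0 | U2 \<Rightarrow> 0 |
     Z1 \<Rightarrow> coeff Q 1 | Z2 \<Rightarrow> coeff Q 2 | Z3 \<Rightarrow> coeff Q 3 |
     C0 \<Rightarrow> coeff R 0 | C1 \<Rightarrow> coeff R 1 | C2 \<Rightarrow> coeff R 2 | C3 \<Rightarrow> 0 | Y \<Rightarrow> coeff Q 0)" for i
  have g: "(\<Sum>i\<in>UNIV. g i * v $ i) = poly P (v $ C1)" if "v \<in> A" for v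
  proof -
    obtain x a b where "v = scroll_point x (poly h x) a b"
      using \<open>v \<in> A\<close> A(1) by (auto simp: curve_def)
    then show ?thesis
      using poly_cubic[OF degQ, of x] poly_cubic[of R x] degR R3
      by (simp add: PQR UNIV_coord g_def algebra_simps)
  qed
  show thesis
  proof (rule that[of g])
    show "(\<Sum>i\<in>UNIV. g i * v $ i) = 0" if "v \<in> A - {w}" for v
      using that g[of v] by (auto simp: P_def poly_prod)
    show "(\<Sum>i\<in>UNIV. g i * w $ i) \<noteq> 0"
      using g[OF w] A(2) w by (auto simp: P_def poly_prod inj_on_def)
  qed (simp_all add: g_def)
qed

text \<open>The functional separating \<open>w\<close> from the rest of \<open>A\<close> kills every
  other term of the sum, and also \<open>d\<close>, which lives on \<open>U1\<close>,
  \<open>U2\<close>. Allowing such a \<open>d\<close> instead of only zero shows that the span of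
  \<open>A\<close> meets the vertex of the cone trivially.\<close>

lemma curve_combination_zero:
  fixes A :: "('f :: {field, finite} ^ coord) set"
  assumes A: "A \<subseteq> curve h" "inj_on (\<lambda>v. v $ C1) A" "card A \<le> 7" and h: "degree h = 3"
    and d: "(\<Sum>v\<in>A. c v *s v) = d" "\<And>i. i \<noteq> U1 \<Longrightarrow> i \<noteq> U2 \<Longrightarrow> d $ i = 0"
    and w: "w \<in> A"
  shows "c w = 0"
proof -
  obtain g where g: "g U1 = 0" "g U2 = 0"
    "\<And>v. v \<in> A - {w} \<Longrightarrow> (\<Sum>i\<in>UNIV. g i * v $ i) = 0" "(\<Sum>i\<in>UNIV. g i * w $ i) \<noteq> 0"
    using separating_functional[OF A h w] by blast
  have "g i * d $ i = 0" for i
    using g(1,2) d(2)[of i] by (cases "i = U1 \<or> i = U2") auto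
  then have "0 = (\<Sum>i\<in>UNIV. g i * d $ i)"
    by (intro sum.neutral[symmetric] ballI)
  also have "\<dots> = (\<Sum>i\<in>UNIV. \<Sum>v\<in>A. c v * (g i * v $ i))"
    by (simp add: d(1)[symmetric] sum_component sum_distrib_left mult.left_commute)
  also have "\<dots> = (\<Sum>v\<in>A. \<Sum>i\<in>UNIV. c v * (g i * v $ i))"
    by (rule sum.swap)
  also have "\<dots> = (\<Sum>v\<in>A. c v * (\<Sum>i\<in>UNIV. g i * v $ i))"
    by (simp add: sum_distrib_left)
  also have "\<dots> = (\<Sum>v\<in>{w}. c v * (\<Sum>i\<in>UNIV. g i * v $ i))"
    using g(3) w by (intro sum.mono_neutral_right) auto
  finally show ?thesis
    using g(4) by simp
qed

lemma independent_curve: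
  fixes A :: "('f :: {field, finite} ^ coord) set"
  assumes "A \<subseteq> curve h" "inj_on (\<lambda>v. v $ C1) A" "card A \<le> 7" "degree h = 3"
  shows "vec.independent A"
proof (rule vec.independent_if_scalars_zero)
  fix c v assume "(\<Sum>v\<in>A. c v *s v) = 0" "v \<in> A"
  then show "c v = 0"
    using curve_combination_zero[OF assms, of c 0 v] by simp
qed simp

text \<open>Projection from the vertex is injective on the span of \<open>A\<close>: the difference
  \<open>v - w\<close> lies in the vertex, so all its coefficients vanish.\<close>

lemma span_curve_eqI:
  fixes A :: "('f :: {field, finite} ^ coord) set"
  assumes A: "A \<subseteq> curve h" "inj_on (\<lambda>v. v $ C1) A" "card A \<le> 7" "degree h = 3"
    and vw: "v \<in> vec.span A" "w \<in> vec.span A" "\<And>i. i \<noteq> U1 \<Longrightarrow> i \<noteq> U2 \<Longrightarrow> v $ i = w $ i"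
  shows "v = w"
proof -
  have "v - w \<in> vec.span A"
    using vw by (simp add: vec.span_diff)
  then obtain c where c: "(\<Sum>u\<in>A. c u *s u) = v - w"
    by (auto simp: vec.span_finite)
  have "c u = 0" if "u \<in> A" for u
    using curve_combination_zero[OF A c _ that] vw(3) by simp
  then have "(\<Sum>u\<in>A. c u *s u) = 0"
    by simp
  then show ?thesis
    using c by simp
qed

text \<open>
  The hyperplane \<open>Y = h\<^sub>0 C0 + h\<^sub>1 C1 + h\<^sub>2 C2 + h\<^sub>3 C3\<close> avoids the affine pieces because the
  coefficients are nonzero.
\<close>

lemma points_in_span_curve:
  fixes A :: "('f :: {field, finite} ^ coord) set"
  assumes A: "A \<subseteq> curve [:h0, h1, h2, h3:]"
    and h: "h0 \<noteq> 0" "h1 \<noteq> 0" "h2 \<noteq> 0" "h3 \<noteq> 0"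
  shows "points \<inter> vec.span A \<subseteq> curve [:h0, h1, h2, h3:]"
proof
  fix v assume v: "v \<in> points \<inter> vec.span A"
  let ?H = "{v :: 'f ^ coord. v $ Y = h0 * v $ C0 + h1 * v $ C1 + h2 * v $ C2 + h3 * v $ C3}"
  have "vec.subspace ?H"
    by (auto simp: vec.subspace_def algebra_simps)
  moreover have "A \<subseteq> ?H"
    using A by (auto simp: curve_def algebra_simps power2_eq_square power3_eq_cube)
  ultimately have eq: "v $ Y = h0 * v $ C0 + h1 * v $ C1 + h2 * v $ C2 + h3 * v $ C3"
    using vec.span_minimal[of A ?H] v by blast
  have "v \<notin> affine_points"
    using eq h by (auto simp: affine_points_def tops_def)
  then obtain x y a b where v': "v = scroll_point x y a b"
    using v by (auto simp: points_def)
  moreover have "y = poly [:h0, h1, h2, h3:] x"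
    using eq by (simp add: v' algebra_simps power2_eq_square power3_eq_cube)
  ultimately show "v \<in> curve [:h0, h1, h2, h3:]"
    by (auto simp: curve_def)
qed

text \<open>Adding any point \<open>z\<close> to \<open>A\<close> gives a relaxed set of size 8.
  This is clear if \<open>z\<close> is outside the span. Otherwise all points in the span lie on the
  curve and have distinct \<open>C1\<close> coordinates, so any 7 of them are independent and the
  hyperplane is uniform. Hence the 7-set itself is a flat, even when its linear span contains more
  points.\<close>

lemma rank_flat_curve:
  fixes A :: "('f :: {field, finite} ^ coord) set"
  assumes A: "A \<subseteq> curve [:h0, h1, h2, h3:]" "inj_on (\<lambda>v. v $ C1) A" "card A = 7"
    and h: "h0 \<noteq> 0" "h1 \<noteq> 0" "h2 \<noteq> 0" "h3 \<noteq> 0"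
  shows "rank_flat points (relaxed points 8) 7 A"
  unfolding rank_flat_def
proof (intro conjI allI impI)
  let ?h = "[:h0, h1, h2, h3:]"
  have deg: "degree ?h = 3"
    using h by simp
  have indA: "vec.independent A"
    using independent_curve[OF A(1,2) _ deg] A(3) by simp
  show AE: "A \<subseteq> points"
    using A(1) unfolding curve_def points_def by blast
  then have relA: "relaxed points 8 A"
    using indA A(3) by (simp add: relaxed_def)
  show "matroid_rank (relaxed points 8) A = 7"
  proof (rule matroid_rank_eqI[where I = A])
    show "card J \<le> 7" if "J \<subseteq> A" for J
      using card_mono[OF _ that] A(3) by simp
  qed (use relA A(3) in simp_all)
  fix G assume G: "A \<subset> G \<and> G \<subseteq> points"
  then obtain z where z: "z \<in> G" "z \<notin> A"
    by blast
  have card: "card (insert z A) = 8"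
    using z A(3) by simp
  have "relaxed points 8 (insert z A)"
  proof (cases "z \<in> vec.span A")
    case False
    then show ?thesis
      using indA AE z G card by (auto simp: relaxed_def vec.independent_insertI)
  next
    case True
    have "vec.independent B" if B: "B \<subseteq> points \<inter> vec.span (insert z A)" "card B < 8" for B
    proof -
      have B': "B \<subseteq> points \<inter> vec.span A"
        using B(1) True by (simp add: vec.span_redundant)
      then have Bh: "B \<subseteq> curve ?h"
        using points_in_span_curve[OF A(1) h] by blast
      have "inj_on (\<lambda>v. v $ C1) B"
      proof (rule inj_onI)
        fix v w assume vw: "v \<in> B" "w \<in> B" "v $ C1 = w $ C1"
        obtain x a b x' a' b' where
          "v = scroll_point x (poly ?h x) a b" "w = scroll_point x' (poly ?h x') a' b'"
          using vw Bh unfolding curve_def by blast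
        then have eq: "v $ i = w $ i" if "i \<noteq> U1" "i \<noteq> U2" for i
          using vw(3) that by (cases i) simp_all
        show "v = w"
          by (rule span_curve_eqI[OF A(1,2) _ deg _ _ eq]) (use A(3) vw B' in auto)
      qed
      then show ?thesis
        using independent_curve[OF Bh _ _ deg] B(2) by simp
    qed
    then show ?thesis
      using AE z G card by (auto simp: relaxed_def)
  qed
  then have "card (insert z A) \<le> matroid_rank (relaxed points 8) G"
    using z G by (intro card_le_matroid_rank) auto
  then show "matroid_rank (relaxed points 8) G \<noteq> 7"
    using card by simp
qed

section \<open>Counting flats of ranks 7 and 5\<close>

text \<open>A flat is built from 7 parameters \<open>x\<close>, four nonzero coefficients of a cubic
  and a pair \<open>(a, b)\<close> for each \<open>x\<close>. All are recovered from it: the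
  parameters from \<open>C1\<close>, the cubic by interpolating the \<open>Y\<close> coordinates,
  the pairs from \<open>U1\<close> and \<open>U2\<close>.\<close>

lemma num_flats_seven_ge:
  "(CARD('f) choose 7) * ((CARD('f) - 1) ^ 4 * CARD('f) ^ 14)
     \<le> num_flats (points :: ('f :: {field, finite} ^ coord) set) (relaxed points 8) 7"
proof -
  let ?q = "CARD('f)"
  let ?N = "UNIV - {0 :: 'f}"
  define T where "T = (SIGMA S : {S :: 'f set. card S = 7}.
    (?N \<times> ?N \<times> ?N \<times> ?N) \<times> (S \<rightarrow>\<^sub>E (UNIV :: ('f \<times> 'f) set)))"
  define p where "p h u x = scroll_point x (poly h x) (fst (u x)) (snd (u x))"
    for h :: "'f poly" and u x
  define flat where "flat = (\<lambda>(S, (h0, h1, h2, h3), u). p [:h0, h1, h2, h3:] u ` S)"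
  have p_C1 [simp]: "p h u x $ C1 = x" for h u x
    by (simp add: p_def)
  have p_curve: "p h u x \<in> curve h" for h u x
    by (auto simp: p_def curve_def)
  have inj: "inj_on flat T"
  proof (rule inj_onI)
    fix s t assume "s \<in> T" "t \<in> T" and eq: "flat s = flat t"
    then obtain S h0 h1 h2 h3 u S' k0 k1 k2 k3 u' where
      s: "s = (S, (h0, h1, h2, h3), u)" "card S = 7" "u \<in> S \<rightarrow>\<^sub>E UNIV" and
      t: "t = (S', (k0, k1, k2, k3), u')" "u' \<in> S' \<rightarrow>\<^sub>E UNIV"
      unfolding T_def by (elim SigmaE) auto
    let ?h = "[:h0, h1, h2, h3:]" and ?k = "[:k0, k1, k2, k3:]"
    have eq': "p ?h u ` S = p ?k u' ` S'"
      using eq by (simp add: flat_def s t)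
    have "S = (\<lambda>v. v $ C1) ` p ?h u ` S"
      by (simp add: image_image)
    also have "\<dots> = S'"
      by (simp add: eq' image_image)
    finally have S': "S' = S" by simp
    have pt: "p ?h u x = p ?k u' x" if "x \<in> S" for x
    proof -
      have "p ?h u x \<in> p ?k u' ` S"
        using imageI[OF that, of "p ?h u"] unfolding eq' S' .
      then obtain x' where "x' \<in> S" "p ?h u x = p ?k u' x'"
        by (rule imageE)
      then show ?thesis
        using p_C1[of ?h u x] p_C1[of ?k u' x'] by simp
    qed
    have "poly ?h x = poly ?k x" if "x \<in> S" for x
      using arg_cong[OF pt[OF that], of "\<lambda>v. v $ Y"] unfolding p_def scroll_point_nth .
    moreover have "degree ?h < card S" "degree ?k < card S"
      using s(2) by simp_all
    ultimately have "?h = ?k"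
      by (intro poly_eqI_degree[of S]) auto
    moreover have "u = u'"
    proof (rule PiE_ext)
      show "u x = u' x" if "x \<in> S" for x
        using arg_cong[OF pt[OF that], of "\<lambda>v. v $ U1"] arg_cong[OF pt[OF that], of "\<lambda>v. v $ U2"]
        by (simp add: p_def prod_eq_iff)
    qed (use s t S' in auto)
    ultimately show "s = t"
      using s t S' by simp
  qed
  have sub: "flat ` T \<subseteq> {F. rank_flat points (relaxed points 8) 7 F}"
  proof clarify
    fix S :: "'f set" and h0 h1 h2 h3 :: 'f and u
    assume "(S, (h0, h1, h2, h3), u) \<in> T"
    then have S: "card S = 7" and h: "h0 \<noteq> 0" "h1 \<noteq> 0" "h2 \<noteq> 0" "h3 \<noteq> 0"
      by (auto simp: T_def)
    let ?p = "p [:h0, h1, h2, h3:] u"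
    have "inj_on ?p S"
      by (rule inj_onI) (metis p_C1)
    then have "card (?p ` S) = 7"
      using S by (simp add: card_image)
    moreover have "inj_on (\<lambda>v. v $ C1) (?p ` S)"
      by (auto intro!: inj_onI)
    ultimately show "rank_flat points (relaxed points 8) 7 (flat (S, (h0, h1, h2, h3), u))"
      using p_curve h by (auto simp: flat_def intro!: rank_flat_curve[of _ h0 h1 h2 h3])
  qed
  have fibre: "card ((?N \<times> ?N \<times> ?N \<times> ?N) \<times> (S \<rightarrow>\<^sub>E (UNIV :: ('f \<times> 'f) set))) =
      (?q - 1) ^ 4 * ?q ^ 14" if "card S = 7" for S :: "'f set"
  proof -
    have "card (S \<rightarrow>\<^sub>E (UNIV :: ('f \<times> 'f) set)) = (?q * ?q) ^ 7"
      using that by (simp add: card_PiE)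
    also have "\<dots> = ?q ^ 14"
      by (simp add: power_mult_distrib flip: power_add)
    finally show ?thesis
      by (simp add: card_cartesian_product card_Diff_singleton power4_eq_xxxx)
  qed
  have "card T = (\<Sum>S\<in>{S :: 'f set. card S = 7}. (?q - 1) ^ 4 * ?q ^ 14)"
  proof -
    have "card T = (\<Sum>S\<in>{S :: 'f set. card S = 7}.
        card ((?N \<times> ?N \<times> ?N \<times> ?N) \<times> (S \<rightarrow>\<^sub>E (UNIV :: ('f \<times> 'f) set))))"
      unfolding T_def by (rule card_SigmaI) (auto intro!: finite_PiE)
    also have "\<dots> = (\<Sum>S\<in>{S :: 'f set. card S = 7}. (?q - 1) ^ 4 * ?q ^ 14)"
      by (rule sum.cong[OF refl], rule fibre, erule CollectD)
    finally show ?thesis .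
  qed
  also have "\<dots> = (?q choose 7) * ((?q - 1) ^ 4 * ?q ^ 14)"
    using n_subsets[of "UNIV :: 'f set" 7] by simp
  finally have "card (flat ` T) = (?q choose 7) * ((?q - 1) ^ 4 * ?q ^ 14)"
    using inj by (simp add: card_image)
  then show ?thesis
    using card_mono[OF _ sub] by (simp add: num_flats_def)
qed

text \<open>The function \<open>w\<close> holds the 25 free coordinates of one point from each
  affine piece. The five points are independent by their \<open>tops\<close> coordinates, and each
  is the only vector of their span with its \<open>tops\<close> coordinates, so the flat determines
  \<open>w\<close>.\<close>

lemma num_flats_five_ge:
  "CARD('f) ^ 25 \<le> num_flats (points :: ('f :: {field, finite} ^ coord) set) (relaxed points 8) 5"
proof -
  define e :: "(coord \<times> coord \<Rightarrow> 'f) \<Rightarrow> coord \<Rightarrow> 'f ^ coord"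
    where "e w k = (\<chi> i. if i \<in> tops then of_bool (i = k) else w (k, i))" for w k
  define flat where "flat w = points \<inter> vec.span (e w ` tops)" for w
  let ?T = "(tops \<times> - tops) \<rightarrow>\<^sub>E (UNIV :: 'f set)"
  have e_top: "e w k $ i = of_bool (i = k)" if "i \<in> tops" for w k i
    using that by (simp add: e_def)
  have e_inj: "inj_on (e w) tops" for w
    by (rule inj_onI) (metis e_top of_bool_eq_iff)
  have e_points: "e w ` tops \<subseteq> points" for w
    by (auto simp: points_def affine_points_def e_top)
  have ind: "vec.independent (e w ` tops)" for w
  proof -
    have "e w k \<notin> vec.span (e w ` tops - {e w k})" if k: "k \<in> tops" for k
    proof -
      have "vec.subspace {v :: 'f ^ coord. v $ k = 0}"
        by (auto simp: vec.subspace_def)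
      moreover have "e w ` tops - {e w k} \<subseteq> {v. v $ k = 0}"
        using k by (auto simp: e_top)
      ultimately have "vec.span (e w ` tops - {e w k}) \<subseteq> {v. v $ k = 0}"
        by (rule vec.span_minimal[rotated])
      then show ?thesis
        using e_top[OF k, of w k] by auto
    qed
    then show ?thesis
      by (auto simp: vec.dependent_def)
  qed
  have span_top: "v = e w k" if v: "v \<in> vec.span (e w ` tops)" and k: "k \<in> tops"
    and vk: "\<And>i. i \<in> tops \<Longrightarrow> v $ i = of_bool (i = k)" for v w k
  proof -
    \<comment> \<open>These are the vectors whose own \<open>tops\<close> coordinates serve as
      coefficients. They form a subspace containing the generators, hence the whole span.\<close>
    let ?H = "{v :: 'f ^ coord. v = (\<Sum>i\<in>tops. v $ i *s e w i)}"
    have unit: "(\<Sum>i\<in>tops. of_bool (i = l) *s e w i) = e w l" if "l \<in> tops" for l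
    proof -
      have "(\<Sum>i\<in>tops. of_bool (i = l) *s e w i) = (\<Sum>i\<in>tops. if i = l then e w i else 0)"
        by (intro sum.cong) auto
      then show ?thesis
        using that by (simp add: tops_def)
    qed
    have "vec.subspace ?H"
      by (auto simp: vec.subspace_def vec.scale_left_distrib sum.distrib
        simp flip: vec.scale_scale vec.scale_sum_right)
    moreover have "e w ` tops \<subseteq> ?H"
      using unit by (auto simp: e_top cong: sum.cong)
    ultimately have "v = (\<Sum>i\<in>tops. v $ i *s e w i)"
      using vec.span_minimal[of "e w ` tops" ?H] v by blast
    also have "\<dots> = e w k"
      using unit[OF k] vk by (simp cong: sum.cong)
    finally show ?thesis .
  qed
  have "inj_on flat ?T"
  proof (rule inj_onI)
    fix w w' assume w: "w \<in> ?T" "w' \<in> ?T" and eq: "flat w = flat w'"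
    show "w = w'"
    proof (rule PiE_ext[OF w])
      fix ki assume ki: "ki \<in> tops \<times> - tops"
      obtain k i where ki': "ki = (k, i)" "k \<in> tops" "i \<notin> tops"
        using ki by auto
      have "e w k \<in> flat w"
        using e_points[of w] ki' by (auto simp: flat_def intro: vec.span_base)
      then have "e w k \<in> vec.span (e w' ` tops)"
        using eq by (auto simp only: flat_def)
      then have "e w k = e w' k"
        using ki'(2) by (rule span_top) (rule e_top)
      then have "e w k $ i = e w' k $ i"
        by simp
      then show "w ki = w' ki"
        using ki' by (simp add: e_def)
    qed
  qed
  then have card: "card (flat ` ?T) = card ?T"
    by (rule card_image)
  have "- tops = {U1, U2, Z1, Z2, Z3}"
    using UNIV_coord by (auto simp: tops_def)
  then have "card (tops \<times> - tops) = 25"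
    by (simp add: card_cartesian_product) (simp add: tops_def)
  then have "card ?T = CARD('f) ^ 25"
    by (subst card_PiE) simp_all
  moreover have "flat w \<in> {F. rank_flat points (relaxed points 8) 5 F}" for w
  proof
    have "card (e w ` tops) = 5"
      using e_inj[of w] by (simp add: card_image) (simp add: tops_def)
    then show "rank_flat points (relaxed points 8) 5 (flat w)"
      unfolding flat_def using e_points ind by (intro rank_flat_relaxed_span) auto
  qed
  ultimately show ?thesis
    using card_mono[of "{F. rank_flat points (relaxed points 8) 5 F}" "flat ` ?T"] card
    by (simp add: num_flats_def image_subset_iff)
qed

section \<open>Failure of unimodality\<close>

lemma not_unimodal_points:
  assumes q: "CARD('f :: {field, finite}) > 4 * 7 ^ 7"
  shows "\<not> unimodal_upto (matroid_rank (relaxed points 8) (points :: ('f ^ coord) set))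
    (num_flats (points :: ('f ^ coord) set) (relaxed points 8))"
proof -
  let ?E = "points :: ('f ^ coord) set"
  let ?W = "num_flats ?E (relaxed ?E 8)"
  define q m where "q = CARD('f)" and "m = q - 1"
  have q_m: "q = Suc m" and q_gt: "q > 4 * 7 ^ 7"
    using q by (simp_all add: q_def m_def)
  \<comment> \<open>The ratio 10/9 is small enough that its sixth power is still below 2, as
    \<open>pow4\<close> and \<open>pow6\<close> require.\<close>
  have qm: "9 * q \<le> 10 * m"
    using q_gt by (simp add: q_m)
  have pow: "9 ^ k * q ^ k \<le> 10 ^ k * m ^ k" for k
    using power_mono[OF qm, of k] by (simp add: power_mult_distrib)
  have pow4: "q ^ 4 \<le> 2 * m ^ 4" and pow6: "q ^ 6 \<le> 2 * m ^ 6"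
    using pow[of 4] pow[of 6] by simp_all
  have five: "q ^ 25 \<le> ?W 5"
    using num_flats_five_ge[where ?'f = 'f] by (simp add: q_def)
  have six: "?W 6 \<le> 2 * q ^ 24"
  proof -
    have "?W 6 * (q ^ 6 - q ^ 5) ^ 6 \<le> (q ^ 10) ^ 6"
      using num_flats_relaxed_le[of 5 8 ?E] by (simp add: q_def)
    moreover have "q ^ 6 - q ^ 5 = q ^ 5 * m"
      by (simp add: m_def algebra_simps eval_nat_numeral)
    ultimately have le: "?W 6 * (q ^ 30 * m ^ 6) \<le> q ^ 60"
      by (simp add: power_mult_distrib flip: power_mult)
    \<comment> \<open>Both sides are scaled by \<open>q ^ 36\<close>, cancelled at the end, to avoid
      division in the natural numbers.\<close>
    have "?W 6 * q ^ 36 = ?W 6 * q ^ 30 * q ^ 6"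
      by (simp flip: power_add)
    also have "\<dots> \<le> ?W 6 * q ^ 30 * (2 * m ^ 6)"
      using pow6 by (rule mult_le_mono2)
    also have "\<dots> \<le> 2 * q ^ 60"
      using le by simp
    also have "\<dots> = 2 * q ^ 24 * q ^ 36"
      by (simp flip: power_add)
    finally show ?thesis
      using q_m by simp
  qed
  have seven: "2 * q ^ 24 < ?W 7"
  proof -
    have "(real q / 7) ^ 7 \<le> real (q choose 7)"
      using binomial_ge_n_over_k_pow_k[of 7 q, where ?'a = real] q_gt by simp
    then have "real (q ^ 7) \<le> real (7 ^ 7 * (q choose 7))"
      by (simp add: power_divide field_simps)
    then have choose: "q ^ 7 \<le> 7 ^ 7 * (q choose 7)"
      unfolding of_nat_le_iff .
    \<comment> \<open>In the bound on \<open>q\<close>, the factor \<open>7 ^ 7\<close> absorbs the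
      loss in the binomial estimate, one factor 2 comes from \<open>pow4\<close> and the other from
      the bound on \<open>?W 6\<close>.\<close>
    have "4 * 7 ^ 7 * q ^ 24 < q * q ^ 24"
      using q_gt by (intro mult_strict_right_mono) auto
    also have "\<dots> = q ^ 7 * (q ^ 4 * q ^ 14)"
      by (simp flip: power_add power_Suc)
    also have "\<dots> \<le> 7 ^ 7 * (q choose 7) * (2 * m ^ 4 * q ^ 14)"
      using choose pow4 by (intro mult_le_mono) auto
    also have "\<dots> = 2 * 7 ^ 7 * ((q choose 7) * (m ^ 4 * q ^ 14))"
      by simp
    also have "\<dots> \<le> 2 * 7 ^ 7 * ?W 7"
      using num_flats_seven_ge[where ?'f = 'f] by (simp add: q_def m_def)
    finally show ?thesis
      by simp
  qed
  have "2 * q ^ 24 < q ^ 25"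
    using q_gt by (simp add: power_Suc[of q 24, simplified])
  then have drop: "?W 6 < ?W 5" and rise: "?W 6 < ?W 7"
    using five six seven by simp_all
  \<comment> \<open>The rise from index 6 to 7 contradicts unimodality only if index 7 is within
    range; a flat of rank 7 shows that the matroid has rank at least 7.\<close>
  have "{F. rank_flat ?E (relaxed ?E 8) 7 F} \<noteq> {}"
    using rise unfolding num_flats_def by (metis card.empty not_less_zero)
  then obtain F where "F \<subseteq> ?E" "matroid_rank (relaxed ?E 8) F = 7"
    by (auto simp: rank_flat_def)
  moreover have "relaxed ?E 8 {}"
    by (simp add: relaxed_def vec.independent_empty)
  ultimately obtain I where "I \<subseteq> ?E" "relaxed ?E 8 I" "card I = 7"
    using matroid_rank_attained[of F "relaxed ?E 8"] by (metis finite order_trans)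
  then have rank: "7 \<le> matroid_rank (relaxed ?E 8) ?E"
    using card_le_matroid_rank[of I ?E "relaxed ?E 8"] by simp
  show ?thesis
  proof
    assume "unimodal_upto (matroid_rank (relaxed ?E 8) ?E) ?W"
    then obtain k where
      up: "\<And>i. i < k \<Longrightarrow> ?W i \<le> ?W (Suc i)" and
      down: "\<And>i. k \<le> i \<Longrightarrow> i < matroid_rank (relaxed ?E 8) ?E \<Longrightarrow> ?W (Suc i) \<le> ?W i"
      unfolding unimodal_upto_def by blast
    show False
    proof (cases "k \<le> 6")
      case True
      then show False
        using down[of 6] rank rise by simp
    next
      case False
      then show False
        using up[of 5] drop by simp
    qed
  qed
qed

section \<open>A prime field of large order\<close>

definition big_prime :: nat where
  "big_prime = (SOME p. prime p \<and> p > 4 * 7 ^ 7)"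

lemma big_prime: "prime big_prime" "big_prime > 4 * 7 ^ 7"
  using someI_ex[OF bigger_prime[of "4 * 7 ^ 7"]] by (simp_all add: big_prime_def)

text \<open>Only the number of elements matters: since it is prime, \<open>residue mod_ring\<close>
  is a field with \<open>big_prime\<close> elements.\<close>

typedef residue = "{..<big_prime}"
  using prime_gt_0_nat[OF big_prime(1)] by auto

lemma CARD_residue: "CARD(residue) = big_prime"
  using type_definition.card[OF type_definition_residue] by simp

instance residue :: prime_card
proof
  show "prime CARD(residue)"
    by (simp add: CARD_residue big_prime)
qed

theorem theorem1p2:
  shows "\<exists>(ground :: nat set) (indep :: nat set \<Rightarrow> bool).
    matroid ground indep \<and>
    \<not> unimodal_upto (matroid_rank indep ground) (num_flats ground indep)"
proof -
  let ?E = "points :: (residue mod_ring ^ coord) set"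
  have "matroid ?E (relaxed ?E 8)"
    by (rule matroid_relaxed) simp
  then obtain ground :: "nat set" and indep where M: "matroid ground indep"
    "matroid_rank indep ground = matroid_rank (relaxed ?E 8) ?E"
    "\<And>i. num_flats ground indep i = num_flats ?E (relaxed ?E 8) i"
    by (rule transport_to_nat) blast
  have "num_flats ground indep = num_flats ?E (relaxed ?E 8)"
    using M(3) by (rule ext)
  then have "\<not> unimodal_upto (matroid_rank indep ground) (num_flats ground indep)"
    using not_unimodal_points[where ?'f = "residue mod_ring"] big_prime(2) M(2)
    by (simp add: CARD_residue)
  then show ?thesis
    using M(1) by blast
qed

end
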